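(* Let $n\ge 1$. The crossout correspondence $w\mapsto (p_A(w),p_B(w),(\ell_i)_{i=1}^n,(m_i)_{i=1}^n)$ is a bijection between the symmetric group $\mathfrak{S}_{2n}$ and the set of all 4-tuples $(p_A,p_B,(\ell_i)_{i=1}^n,(m_i)_{i=1}^n)$ such that: (i) $p_A$ is a Dyck path of length $2n$; (ii) $p_B$ is a Dyck path of length $2n+2$; (iii) $\ell_i$ are integers with $1\le \ell_i\le h_i(p_A)$ for all $i=1,\dots,n$; (iv) $m_i$ are integers with $1\le m_i\le h_i^*(p_B)$ for all $i=1,\dots,n$.
   Context: A Dyck path of length $2N$ is a lattice path from $(0,0)$ to $(2N,0)$ with steps $(1,1)$ (up) and $(1,-1)$ (down) staying weakly above the $x$-axis. Its set of down steps $D(p)\subset[2N]$ is the set of $k$ such that the segment from $(k-1,h)$ to $(k,h-1)$ lies on $p$ for some $h$; this $h$ is the height of that down step. A path is determined by $D(p)$. For a Dyck path $p$, $h_i(p)$ is the height of the $i$th down step (from the left), and $h_i^*(p)=h_i(p)-1$ if there is no up step to the right of the $i$th down step, and $h_i^*(p)=h_i(p)$ otherwise. Crossout procedure: for $w\in\mathfrak{S}_{2n}$ written in one-line notation $w(1)\cdots w(2n)$, repeat until all positions are marked: mark "B" at the unmarked position $i$ with smallest value $w(i)$, then mark "A" at the leftmost unmarked position. Let $\mathcal{A}(w)$, $\mathcal{B}(w)$ be the sets of positions marked A and B (each of size $n$). $p_A(w)$ is the Dyck path of length $2n$ with down-step set $\{w(a): a\in\mathcal{A}(w)\}$; $p_B(w)$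 is the Dyck path of length $2n+2$ with down-step set $\{b+1: b\in\mathcal{B}(w)\}\cup\{2n+2\}$. Labels: write $\mathcal{A}(w)=\{a_1<\dots<a_n\}$ and let $J\in\mathfrak{S}_n$ be such that $w(a_i)$ is the $J(i)$th down step of $p_A(w)$; set $\ell_{J(i)}=1+\#\{j<i: w(a_j)>w(a_i)\}$. Write $\mathcal{B}(w)=\{b_1,\dots,b_n\}$ ordered so that $w(b_1)<\dots<w(b_n)$, and let $K\in\mathfrak{S}_n$ be such that $b_i+1$ is the $K(i)$th down step of $p_B(w)$; set $m_{K(i)}=1+\#\{j<i: b_j>b_i\}$. (The last down step $2n+2$ of $p_B$ gets no label.) The crossout correspondence sends $w$ to $(p_A(w),p_B(w),(\ell_i)_{i=1}^n,(m_i)_{i=1}^n)$. *)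

theory Defs
  imports "HOL-Combinatorics.Permutations"
begin

text \<open>A lattice path starting at \<open>(0,0)\<close> is given by its list of steps. Steps,
  positions and down steps are numbered from 1, so that the \<open>k\<close>-th step of \<open>p\<close>, which joins abscissa \<open>k - 1\<close> to abscissa \<open>k\<close>, is \<open>p ! (k - 1)\<close>.\<close>

datatype step = Up | Down

fun step_value :: "step \<Rightarrow> int" where
  "step_value Up = 1"
| "step_value Down = -1"

definition path_height :: "step list \<Rightarrow> nat \<Rightarrow> int" where
  "path_height p k = (\<Sum>s\<leftarrow>take k p. step_value s)"

definition dyck_path :: "nat \<Rightarrow> step list \<Rightarrow> bool" where
  "dyck_path N p \<longleftrightarrow> length p = 2 * N \<and> path_height p (2 * N) = 0
     \<and> (\<forall>k\<le>2 * N. 0 \<le> path_height p k)"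

definition down_steps :: "step list \<Rightarrow> nat set" where
  "down_steps p = {k \<in> {1..length p}. p ! (k - 1) = Down}"

definition path_with_down_steps :: "nat \<Rightarrow> nat set \<Rightarrow> step list" where
  "path_with_down_steps N S = map (\<lambda>k. if k \<in> S then Down else Up) [1..<2 * N + 1]"

definition nth_down_step :: "step list \<Rightarrow> nat \<Rightarrow> nat" where
  "nth_down_step p i = sorted_list_of_set (down_steps p) ! (i - 1)"

text \<open>The height of a down step is that of its starting point.\<close>

definition down_height :: "step list \<Rightarrow> nat \<Rightarrow> int" where
  "down_height p i = path_height p (nth_down_step p i - 1)"

definition down_height_star :: "step list \<Rightarrow> nat \<Rightarrow> int" where
  "down_height_star p i =
     (if \<exists>k \<in> {1..length p}. nth_down_step p i < k \<and> p ! (k - 1) = Up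
      then down_height p i else down_height p i - 1)"

text \<open>\<open>crossout_marks w X\<close> runs the crossout procedure with \<open>X\<close> as the set of unmarked
  positions and returns the positions subsequently marked A and B, respectively. The
  finiteness test only serves to make the recursion total.\<close>

function crossout_marks :: "(nat \<Rightarrow> nat) \<Rightarrow> nat set \<Rightarrow> nat set \<times> nat set" where
  "crossout_marks w X =
     (if X = {} \<or> infinite X then ({}, {})
      else let b = arg_min_on w X;
               a = Min (X - {b});
               (A, B) = crossout_marks w (X - {b} - {a})
           in (insert a A, insert b B))"
  by pat_completeness auto
termination
proof (relation "measure (\<lambda>(w, X). card X)", goal_cases)
  case 1
  show ?case by simp
next
  case (2 w X b a)
  then have "b \<in> X" by (simp add: arg_min_if_finite(1))
  with 2 have "X - {b} - {a} \<subset> X" "finite X" by auto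
  then show ?case by (simp add: psubset_card_mono)
qed

declare crossout_marks.simps [simp del]

definition crossout_A :: "nat \<Rightarrow> (nat \<Rightarrow> nat) \<Rightarrow> nat set" where
  "crossout_A n w = fst (crossout_marks w {1..2 * n})"

definition crossout_B :: "nat \<Rightarrow> (nat \<Rightarrow> nat) \<Rightarrow> nat set" where
  "crossout_B n w = snd (crossout_marks w {1..2 * n})"

definition path_A :: "nat \<Rightarrow> (nat \<Rightarrow> nat) \<Rightarrow> step list" where
  "path_A n w = path_with_down_steps n (w ` crossout_A n w)"

definition path_B :: "nat \<Rightarrow> (nat \<Rightarrow> nat) \<Rightarrow> step list" where
  "path_B n w = path_with_down_steps (n + 1)
     ((\<lambda>b. b + 1) ` crossout_B n w \<union> {2 * n + 2})"

text \<open>The positions \<open>a\<^sub>1 < \<dots> < a\<^sub>n\<close> marked A, and the positions \<open>b\<^sub>1, \<dots>, b\<^sub>n\<close> marked B in the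
  order \<open>w(b\<^sub>1) < \<dots> < w(b\<^sub>n)\<close>.\<close>

definition pos_A :: "nat \<Rightarrow> (nat \<Rightarrow> nat) \<Rightarrow> nat \<Rightarrow> nat" where
  "pos_A n w i = sorted_list_of_set (crossout_A n w) ! (i - 1)"

definition pos_B :: "nat \<Rightarrow> (nat \<Rightarrow> nat) \<Rightarrow> nat \<Rightarrow> nat" where
  "pos_B n w i = sort_key w (sorted_list_of_set (crossout_B n w)) ! (i - 1)"

definition perm_J :: "nat \<Rightarrow> (nat \<Rightarrow> nat) \<Rightarrow> nat \<Rightarrow> nat" where
  "perm_J n w = (THE J. J permutes {1..n} \<and>
     (\<forall>i\<in>{1..n}. w (pos_A n w i) = nth_down_step (path_A n w) (J i)))"

definition perm_K :: "nat \<Rightarrow> (nat \<Rightarrow> nat) \<Rightarrow> nat \<Rightarrow> nat" where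
  "perm_K n w = (THE K. K permutes {1..n} \<and>
     (\<forall>i\<in>{1..n}. pos_B n w i + 1 = nth_down_step (path_B n w) (K i)))"

text \<open>The label with index \<open>k = J(i)\<close> is computed from \<open>i = J\<inverse>(k)\<close>; similarly for \<open>K\<close>.\<close>

definition labels_A :: "nat \<Rightarrow> (nat \<Rightarrow> nat) \<Rightarrow> int list" where
  "labels_A n w = map (\<lambda>k. let i = inv (perm_J n w) k in
     1 + int (card {j \<in> {1..n}. j < i \<and> w (pos_A n w j) > w (pos_A n w i)})) [1..<n + 1]"

definition labels_B :: "nat \<Rightarrow> (nat \<Rightarrow> nat) \<Rightarrow> int list" where
  "labels_B n w = map (\<lambda>k. let i = inv (perm_K n w) k in
     1 + int (card {j \<in> {1..n}. j < i \<and> pos_B n w j > pos_B n w i})) [1..<n + 1]"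

definition crossout :: "nat \<Rightarrow> (nat \<Rightarrow> nat) \<Rightarrow> step list \<times> step list \<times> int list \<times> int list" where
  "crossout n w = (path_A n w, path_B n w, labels_A n w, labels_B n w)"

end

theory Submission
  imports Defs
begin

text \<open>Let \<open>a\<^sub>k\<close> and \<open>b\<^sub>k\<close> be the positions marked A and B in round \<open>k\<close> of the crossout procedure. Both
  \<open>a\<^sub>k\<close> and \<open>w(b\<^sub>k)\<close> increase with \<open>k\<close>, so \<open>w\<close> is determined by the two sequences \<open>w(a\<^sub>k)\<close> and \<open>b\<^sub>k\<close>: the
  remaining data are the sorted complements of their ranges. The procedure only requires
  \<open>w(b\<^sub>k) < w(a\<^sub>k)\<close> and \<open>a\<^sub>k < b\<^sub>k\<^sub>+\<^sub>1\<close>, that is, \<open>k \<le> u(w(a\<^sub>k))\<close> and \<open>k \<le> u'(b\<^sub>k) + 1\<close>, where \<open>u\<close> and \<open>u'\<close> count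
  the smaller elements of these complements. Hence the two sequences are independent of each
  other, and it remains to encode each of them by a labelled Dyck path. The down steps of the path
  record the range \<open>S\<close> of the sequence, and the labels form its Lehmer code. Finally, for monotone
  \<open>U\<close>, an ordering \<open>x\<^sub>1, \<dots>, x\<^sub>n\<close> of \<open>S\<close> satisfies \<open>k \<le> U(x\<^sub>k)\<close> for all \<open>k\<close> iff the label of every
  \<open>s \<in> S\<close> is at most \<open>U(s) - #{t \<in> S. t < s}\<close>, which is the height of the down step at \<open>s\<close>
  (or the modified height \<open>h\<^sup>*\<close>, for \<open>U = min n (u' + 1)\<close>).\<close>

section \<open>Lehmer codes\<close>

text \<open>The Lehmer code of \<open>xs\<close>, indexed by entries rather than by places, because
  labels belong to down steps, that is, to elements of the range.\<close>

definition inv_before :: "'a::linorder list \<Rightarrow> 'a \<Rightarrow> nat" where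
  "inv_before xs s = length (filter ((<) s) (takeWhile ((\<noteq>) s) xs))"

lemma inv_before_append_Cons:
  assumes "s \<notin> set us"
  shows "inv_before (us @ s # vs) s = length (filter ((<) s) us)"
proof -
  have "takeWhile ((\<noteq>) s) (us @ s # vs) = us"
    using assms by (induction us) auto
  then show ?thesis by (simp add: inv_before_def)
qed

text \<open>A smaller entry neither stops the scan for \<open>s\<close> nor gets counted. Hence a
  new minimum can be inserted without changing the codes of the other entries.\<close>

lemma inv_before_skip_smaller:
  assumes "b < s"
  shows "inv_before (us @ b # vs) s = inv_before (us @ vs) s"
proof -
  have "filter ((<) s) (takeWhile ((\<noteq>) s) (us @ b # vs)) =
        filter ((<) s) (takeWhile ((\<noteq>) s) (us @ vs))"
    using assms by (induction us) auto
  then show ?thesis by (simp add: inv_before_def)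
qed

lemma inv_before_nth:
  assumes "distinct xs" "i < length xs"
  shows "inv_before xs (xs ! i) = card {j. j < i \<and> xs ! i < xs ! j}"
proof -
  have split: "xs = take i xs @ xs ! i # drop (Suc i) xs"
    using assms(2) by (simp add: id_take_nth_drop)
  have "xs ! i \<notin> set (take i xs)"
    using assms by (subst (asm) split) auto
  then have "inv_before xs (xs ! i) = length (filter ((<) (xs ! i)) (take i xs))"
    using inv_before_append_Cons[of "xs ! i" "take i xs" "drop (Suc i) xs"] split by simp
  also have "\<dots> = card {j. j < i \<and> xs ! i < xs ! j}"
    using assms(2) by (auto simp: length_filter_conv_card intro!: arg_cong[where f = card])
  finally show ?thesis .
qed

text \<open>The list is built by inserting its entries in decreasing order. A new minimum
  \<open>b\<close> leaves the other codes alone, and its own code is its index, since everything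
  before it is larger; so \<open>c b\<close> dictates where \<open>b\<close> goes.\<close>

lemma Lehmer_code_ex1:
  fixes S :: "'a::linorder set"
  assumes "finite S" "\<And>s. s \<in> S \<Longrightarrow> c s \<le> card {t \<in> S. s < t}"
  shows "\<exists>!xs. distinct xs \<and> set xs = S \<and> (\<forall>s\<in>S. inv_before xs s = c s)"
  using assms
proof (induction S rule: finite_linorder_min_induct)
  case empty
  then show ?case by auto
next
  case (insert b S)
  have "c s \<le> card {t \<in> S. s < t}" if "s \<in> S" for s
  proof -
    have "{t \<in> insert b S. s < t} = {t \<in> S. s < t}"
      using insert.hyps that by force
    with insert.prems[of s] that show ?thesis by simp
  qed
  from insert.IH[OF this] obtain ys where
    ys: "distinct ys" "set ys = S" "\<forall>s\<in>S. inv_before ys s = c s"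
    and uniq: "\<And>zs. distinct zs \<Longrightarrow> set zs = S \<Longrightarrow> \<forall>s\<in>S. inv_before zs s = c s \<Longrightarrow> zs = ys"
    by blast
  have bS: "b \<notin> S" using insert.hyps by auto
  have at_b: "inv_before (us @ b # vs) b = length us" if "set us \<subseteq> S" for us vs
  proof -
    have "filter ((<) b) us = us"
      using that insert.hyps by (auto simp: filter_id_conv)
    then show ?thesis using that bS by (subst inv_before_append_Cons) auto
  qed
  have "{t \<in> insert b S. b < t} = S" using insert.hyps by auto
  then have cb: "c b \<le> length ys"
    using insert.prems[of b] ys by (simp add: distinct_card[symmetric])
  define xs where "xs = take (c b) ys @ b # drop (c b) ys"
  show ?case
  proof (rule ex1I[of _ xs], intro conjI ballI)
    have "set (take (c b) ys) \<inter> set (drop (c b) ys) = {}"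
      using ys by (simp add: set_take_disj_set_drop_if_distinct)
    moreover have set_td: "set (take (c b) ys) \<union> set (drop (c b) ys) = S"
      using ys by (metis append_take_drop_id set_append)
    ultimately show "distinct xs" using bS ys by (auto simp: xs_def)
    show "set xs = insert b S" using set_td by (auto simp: xs_def)
    fix s assume "s \<in> insert b S"
    then consider "s = b" | "s \<in> S" "b < s" using insert.hyps by auto
    then show "inv_before xs s = c s"
    proof cases
      case 1
      then show ?thesis using at_b[of "take (c b) ys"] set_td cb by (auto simp: xs_def)
    next
      case 2
      then show ?thesis using ys by (simp add: xs_def inv_before_skip_smaller)
    qed
  next
    fix zs assume zs: "distinct zs \<and> set zs = insert b S \<and> (\<forall>s\<in>insert b S. inv_before zs s = c s)"
    then obtain us vs where uv: "zs = us @ b # vs" by (metis insertI1 split_list)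
    have S: "distinct (us @ vs)" "set (us @ vs) = S" using zs bS by (auto simp: uv)
    have "us @ vs = ys"
    proof (rule uniq[OF S], intro ballI)
      fix s assume "s \<in> S"
      then show "inv_before (us @ vs) s = c s"
        using zs insert.hyps inv_before_skip_smaller[of b s us vs] by (auto simp: uv)
    qed
    moreover have "length us = c b" using at_b[of us vs] zs S by (auto simp: uv)
    ultimately show "zs = xs" by (auto simp: xs_def uv)
  qed
qed

text \<open>From right to left the argument is entry by entry: an entry before \<open>s\<close> is
  either counted by \<open>inv_before\<close> or smaller than \<open>s\<close>. From left to right
  the bound at \<open>s\<close> comes from the last entry that is at most \<open>s\<close>, by
  monotonicity of \<open>U\<close>.\<close>

lemma nth_bounded_iff_inv_before_bounded:
  fixes U :: "'a::linorder \<Rightarrow> nat"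
  assumes dist: "distinct xs" and mono: "\<And>s t. s \<le> t \<Longrightarrow> U s \<le> U t"
  shows "(\<forall>i<length xs. i < U (xs ! i)) \<longleftrightarrow>
    (\<forall>s\<in>set xs. inv_before xs s + card {t \<in> set xs. t < s} < U s)"
proof -
  have card_below: "card {t \<in> set xs. P t} = card {j. j < length xs \<and> P (xs ! j)}" for P
  proof -
    have "{t \<in> set xs. P t} = (!) xs ` {j. j < length xs \<and> P (xs ! j)}"
      by (auto simp: set_conv_nth)
    moreover have "inj_on ((!) xs) {j. j < length xs \<and> P (xs ! j)}"
      using dist by (auto simp: inj_on_def nth_eq_iff_index_eq)
    ultimately show ?thesis by (simp add: card_image)
  qed
  show ?thesis
  proof (intro iffI allI impI ballI)
    fix s
    assume A: "\<forall>i<length xs. i < U (xs ! i)" and "s \<in> set xs"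
    then obtain i where i: "i < length xs" "xs ! i = s" by (auto simp: in_set_conv_nth)
    \<comment> \<open>Apart from \<open>s\<close> itself, all elements counted on the left sit at indices up to \<open>m\<close>.\<close>
    define I where "I = {j. j < length xs \<and> xs ! j \<le> s}"
    define m where "m = Max I"
    have fin: "finite I" "i \<in> I" using i by (auto simp: I_def)
    then have "m \<in> I" unfolding m_def by (metis Max_in empty_iff)
    then have m: "m < length xs" "xs ! m \<le> s" by (auto simp: I_def)
    have below_m: "j \<le> m" if "j \<in> I" for j using fin that by (simp add: m_def)
    then have "i \<le> m" using fin by blast
    have "inv_before xs s + card {t \<in> set xs. t < s}
        = card {j. j < i \<and> s < xs ! j} + card {j. j < length xs \<and> xs ! j < s}"
      using i dist inv_before_nth[of xs i] by (simp add: card_below)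
    also have "\<dots> = card ({j. j < i \<and> s < xs ! j} \<union> {j. j < length xs \<and> xs ! j < s})"
      by (rule card_Un_disjoint[symmetric]) auto
    also have "\<dots> \<le> card ({..m} - {i})"
    proof (rule card_mono)
      have "j \<le> m" if "j < length xs" "xs ! j < s" for j
        using below_m[of j] that by (simp add: I_def)
      then show "{j. j < i \<and> s < xs ! j} \<union> {j. j < length xs \<and> xs ! j < s} \<subseteq> {..m} - {i}"
        using \<open>i \<le> m\<close> i by auto
    qed auto
    also have "\<dots> = m" using \<open>i \<le> m\<close> by simp
    also have "\<dots> < U (xs ! m)" using A m by blast
    also have "\<dots> \<le> U s" using mono m by blast
    finally show "inv_before xs s + card {t \<in> set xs. t < s} < U s" .
  next
    fix i
    assume B: "\<forall>s\<in>set xs. inv_before xs s + card {t \<in> set xs. t < s} < U s"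
      and i: "i < length xs"
    have ne: "xs ! j \<noteq> xs ! i" if "j < i" for j
      using dist i that by (simp add: nth_eq_iff_index_eq)
    have "i = card {..<i}" by simp
    also have "{..<i} = {j. j < i \<and> xs ! i < xs ! j} \<union> {j. j < i \<and> xs ! j < xs ! i}"
      using ne by (auto simp: neq_iff)
    also have "card \<dots> \<le> card {j. j < i \<and> xs ! i < xs ! j} + card {j. j < i \<and> xs ! j < xs ! i}"
      by (rule card_Un_le)
    also have "\<dots> \<le> inv_before xs (xs ! i) + card {t \<in> set xs. t < xs ! i}"
      using i dist by (auto simp: inv_before_nth card_below intro!: card_mono)
    also have "\<dots> < U (xs ! i)" using B i by simp
    finally show "i < U (xs ! i)" .
  qed
qed

lemma card_below_sorted_nth:
  fixes S :: "'a::linorder set"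
  assumes "finite S" "k < card S"
  shows "card {t \<in> S. t < sorted_list_of_set S ! k} = k"
proof -
  let ?xs = "sorted_list_of_set S"
  have len: "length ?xs = card S" and set: "set ?xs = S" and dist: "distinct ?xs"
    and sorted: "sorted_wrt (<) ?xs"
    using assms by auto
  have "{t \<in> S. t < ?xs ! k} = (!) ?xs ` {..<k}"
  proof (intro equalityI subsetI)
    fix t assume "t \<in> {t \<in> S. t < ?xs ! k}"
    then obtain j where "j < card S" "t = ?xs ! j" "?xs ! j < ?xs ! k"
      using set len by (metis (mono_tags, lifting) in_set_conv_nth mem_Collect_eq)
    moreover from this have "j < k"
      using sorted len assms(2) by (metis linorder_neqE_nat order.asym sorted_wrt_nth_less)
    ultimately show "t \<in> (!) ?xs ` {..<k}" by auto
  next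
    fix t assume "t \<in> (!) ?xs ` {..<k}"
    then obtain j where "j < k" "t = ?xs ! j" by auto
    then show "t \<in> {t \<in> S. t < ?xs ! k}"
      using sorted len assms(2) set
      by (metis (mono_tags, lifting) mem_Collect_eq nth_mem order.strict_trans sorted_wrt_nth_less)
  qed
  moreover have "inj_on ((!) ?xs) {..<k}"
    using dist len assms(2) by (auto simp: inj_on_def nth_eq_iff_index_eq)
  ultimately show ?thesis by (simp add: card_image)
qed

text \<open>Sorting by value puts the label of each entry at the place of the corresponding down
  step; the added 1 makes labels start at 1.\<close>

definition inv_labels :: "nat list \<Rightarrow> int list" where
  "inv_labels xs = map (\<lambda>s. 1 + int (inv_before xs s)) (sorted_list_of_set (set xs))"

text \<open>The element of rank \<open>k\<close>, counted from 0, has \<open>k\<close> smaller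
  elements, so \<open>nth_bounded_iff_inv_before_bounded\<close> turns bounds on places into bounds
  on labels. As \<open>U s\<close> is at most \<open>card S\<close>, every label within these bounds
  is admissible in \<open>Lehmer_code_ex1\<close>.\<close>

lemma bij_betw_inv_labels:
  fixes U :: "nat \<Rightarrow> nat"
  assumes fin: "finite S" and mono: "\<And>s t. s \<le> t \<Longrightarrow> U s \<le> U t"
    and bound: "\<And>s. s \<in> S \<Longrightarrow> U s \<le> card S"
  shows "bij_betw inv_labels
    {xs. distinct xs \<and> set xs = S \<and> (\<forall>i<card S. i < U (xs ! i))}
    {ls. length ls = card S \<and> (\<forall>k<card S. 1 \<le> ls ! k \<and>
        ls ! k \<le> int (U (sorted_list_of_set S ! k)) - int k)}"
    (is "bij_betw _ ?X ?Y")
proof -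
  let ?srt = "sorted_list_of_set S"
  have srt: "set ?srt = S" "length ?srt = card S" "distinct ?srt"
    using fin by auto
  have ex_k: "\<exists>k<card S. s = ?srt ! k" if "s \<in> S" for s
    using that srt by (metis in_set_conv_nth)
  have X_iff: "xs \<in> ?X \<longleftrightarrow> distinct xs \<and> set xs = S \<and>
      (\<forall>k<card S. inv_before xs (?srt ! k) + k < U (?srt ! k))" for xs
  proof -
    have "(\<forall>i<card S. i < U (xs ! i)) \<longleftrightarrow>
        (\<forall>k<card S. inv_before xs (?srt ! k) + k < U (?srt ! k))"
      if "distinct xs" "set xs = S"
    proof -
      have len: "length xs = card S" using that by (metis distinct_card)
      have "(\<forall>s\<in>S. inv_before xs s + card {t \<in> S. t < s} < U s) \<longleftrightarrow>
          (\<forall>k<card S. inv_before xs (?srt ! k) + k < U (?srt ! k))"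
      proof (intro iffI allI impI ballI)
        fix k assume *: "\<forall>s\<in>S. inv_before xs s + card {t \<in> S. t < s} < U s" "k < card S"
        then have "?srt ! k \<in> S" using srt by (metis nth_mem)
        with * show "inv_before xs (?srt ! k) + k < U (?srt ! k)"
          using card_below_sorted_nth[OF fin, of k] by fastforce
      next
        fix s assume *: "\<forall>k<card S. inv_before xs (?srt ! k) + k < U (?srt ! k)" "s \<in> S"
        obtain k where "k < card S" "s = ?srt ! k" using ex_k *(2) by blast
        with * show "inv_before xs s + card {t \<in> S. t < s} < U s"
          using card_below_sorted_nth[OF fin, of k] by auto
      qed
      then show ?thesis
        using nth_bounded_iff_inv_before_bounded[OF that(1), of U] mono that(2) len by simp
    qed
    then show ?thesis by blast
  qed
  have nth_labels: "inv_labels xs ! k = 1 + int (inv_before xs (?srt ! k))"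
    if "set xs = S" "k < card S" for xs k
    using that srt by (simp add: inv_labels_def)
  show ?thesis
  proof (rule bij_betwI')
    fix xs ys assume X: "xs \<in> ?X" "ys \<in> ?X"
    have "xs = ys" if eq: "inv_labels xs = inv_labels ys"
    proof -
      have same: "inv_before ys s = inv_before xs s" if s: "s \<in> S" for s
      proof -
        obtain k where k: "k < card S" "s = ?srt ! k" using ex_k[OF s] by blast
        have "1 + int (inv_before ys s) = 1 + int (inv_before xs s)"
          using nth_labels[of xs k] nth_labels[of ys k] k X eq by simp
        then show ?thesis by simp
      qed
      \<comment> \<open>Both lists realise the code of \<open>xs\<close>. That code is admissible
        because it counts distinct elements of \<open>S\<close> above \<open>s\<close>.\<close>
      have "\<exists>!zs. distinct zs \<and> set zs = S \<and> (\<forall>s\<in>S. inv_before zs s = inv_before xs s)"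
      proof (rule Lehmer_code_ex1[OF fin])
        fix s assume "s \<in> S"
        have "set (takeWhile ((\<noteq>) s) xs) \<subseteq> S" "distinct (takeWhile ((\<noteq>) s) xs)"
          using X by (auto dest: set_takeWhileD)
        then have "inv_before xs s = card {t \<in> set (takeWhile ((\<noteq>) s) xs). s < t}"
          using distinct_card[of "filter ((<) s) (takeWhile ((\<noteq>) s) xs)"]
          by (simp add: inv_before_def)
        also have "\<dots> \<le> card {t \<in> S. s < t}"
          using \<open>set (takeWhile ((\<noteq>) s) xs) \<subseteq> S\<close> fin by (intro card_mono) auto
        finally show "inv_before xs s \<le> card {t \<in> S. s < t}" .
      qed
      then show "xs = ys" using X same by auto
    qed
    then show "(inv_labels xs = inv_labels ys) = (xs = ys)" by blast
  next
    fix xs assume X: "xs \<in> ?X"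
    then have S: "set xs = S"
      and lt: "\<And>k. k < card S \<Longrightarrow> inv_before xs (?srt ! k) + k < U (?srt ! k)"
      using X_iff by blast+
    have "inv_labels xs ! k \<le> int (U (?srt ! k)) - int k" if "k < card S" for k
      using nth_labels[OF S that] lt[OF that] by linarith
    moreover have "1 \<le> inv_labels xs ! k" if "k < card S" for k
      using nth_labels[OF S that] by simp
    ultimately show "inv_labels xs \<in> ?Y" using S by (auto simp: inv_labels_def)
  next
    fix ls assume "ls \<in> ?Y"
    then have len: "length ls = card S"
      and ge: "\<And>k. k < card S \<Longrightarrow> 1 \<le> ls ! k"
      and le: "\<And>k. k < card S \<Longrightarrow> ls ! k \<le> int (U (?srt ! k)) - int k"
      by auto
    \<comment> \<open>The label of \<open>s\<close> sits at the index given by the rank of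
      \<open>s\<close> in \<open>S\<close>. Labels are at least 1, so \<open>nat\<close> loses
      nothing on \<open>S\<close>.\<close>
    define c where "c s = nat (ls ! card {t \<in> S. t < s} - 1)" for s
    have c_nth: "c (?srt ! k) = nat (ls ! k - 1)" if "k < card S" for k
      using card_below_sorted_nth[OF fin that] by (simp add: c_def)
    have "\<exists>!xs. distinct xs \<and> set xs = S \<and> (\<forall>s\<in>S. inv_before xs s = c s)"
    proof (rule Lehmer_code_ex1[OF fin])
      fix s assume "s \<in> S"
      then obtain k where k: "k < card S" "s = ?srt ! k" using ex_k by blast
      have "S = {t \<in> S. t < s} \<union> insert s {t \<in> S. s < t}" using \<open>s \<in> S\<close> by auto
      then have "card S = card ({t \<in> S. t < s} \<union> insert s {t \<in> S. s < t})" by simp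
      also have "\<dots> = card {t \<in> S. t < s} + card (insert s {t \<in> S. s < t})"
        by (rule card_Un_disjoint) (use fin in auto)
      also have "\<dots> = k + Suc (card {t \<in> S. s < t})"
        using card_below_sorted_nth[OF fin k(1)] k fin by simp
      finally have "card S = k + Suc (card {t \<in> S. s < t})" .
      with le[OF k(1)] bound[OF \<open>s \<in> S\<close>] c_nth[OF k(1)] k
      show "c s \<le> card {t \<in> S. s < t}" by simp
    qed
    then obtain xs where xs: "distinct xs" "set xs = S" "\<forall>s\<in>S. inv_before xs s = c s" by blast
    have cs: "inv_before xs (?srt ! k) = nat (ls ! k - 1)" if "k < card S" for k
      using xs that c_nth srt by (metis nth_mem)
    have "xs \<in> ?X" unfolding X_iff
    proof (intro conjI allI impI)
      fix k assume k: "k < card S"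
      show "inv_before xs (?srt ! k) + k < U (?srt ! k)"
        using cs[OF k] ge[OF k] le[OF k] by linarith
    qed (use xs in auto)
    moreover have "ls = inv_labels xs"
    proof (rule nth_equalityI)
      show "length ls = length (inv_labels xs)" using len xs by (simp add: inv_labels_def)
      fix k assume "k < length ls"
      then show "ls ! k = inv_labels xs ! k"
        using nth_labels[OF xs(2), of k] cs[of k] ge[of k] len by simp
    qed
    ultimately show "\<exists>xs\<in>?X. ls = inv_labels xs" by blast
  qed
qed

section \<open>Runs of the crossout procedure\<close>

text \<open>This turns comparisons with the sorted complement of a sequence into the counts
  \<open>compl_below\<close>.\<close>

lemma sorted_nth_less_iff:
  fixes C :: "'a::linorder set"
  assumes "finite C" "k < card C"
  shows "sorted_list_of_set C ! k < x \<longleftrightarrow> k < card {v \<in> C. v < x}"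
proof
  let ?c = "sorted_list_of_set C ! k"
  assume less: "?c < x"
  have "?c \<in> C"
    using assms by (metis nth_mem set_sorted_list_of_set sorted_list_of_set.length_sorted_key_list_of_set)
  have "Suc k = card (insert ?c {v \<in> C. v < ?c})"
    using assms card_below_sorted_nth[OF assms] by simp
  also have "\<dots> \<le> card {v \<in> C. v < x}"
    using assms less \<open>?c \<in> C\<close> by (intro card_mono) auto
  finally show "k < card {v \<in> C. v < x}" by simp
next
  let ?c = "sorted_list_of_set C ! k"
  assume k: "k < card {v \<in> C. v < x}"
  show "?c < x"
  proof (rule ccontr)
    assume "\<not> ?c < x"
    then have "card {v \<in> C. v < x} \<le> card {v \<in> C. v < ?c}"
      using assms by (intro card_mono) auto
    then show False using k card_below_sorted_nth[OF assms] by simp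
  qed
qed

text \<open>A run of the crossout procedure: in each round it marks the head of the second list
  with B and the head of the first list with A.\<close>

fun crossout_run :: "(nat \<Rightarrow> nat) \<Rightarrow> nat list \<Rightarrow> nat list \<Rightarrow> bool" where
  "crossout_run w [] [] = True"
| "crossout_run w (a # as) (b # bs) =
     ((\<forall>x \<in> insert a (set as \<union> set bs). w b < w x) \<and> (\<forall>x \<in> set as \<union> set bs. a < x) \<and>
      crossout_run w as bs)"
| "crossout_run w as bs = False"

lemma crossout_run_length: "crossout_run w as bs \<Longrightarrow> length as = length bs"
  by (induction w as bs rule: crossout_run.induct) auto

lemma crossout_run_distinct: "crossout_run w as bs \<Longrightarrow> distinct (as @ bs)"
  by (induction w as bs rule: crossout_run.induct) auto

text \<open>In each round the strict inequalities make the head \<open>b\<close> the only minimiser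
  of \<open>w\<close> and the head \<open>a\<close> the least remaining position, so one unfolding
  of the recursion peels off both heads.\<close>

lemma crossout_marks_run:
  "crossout_run w as bs \<Longrightarrow> crossout_marks w (set as \<union> set bs) = (set as, set bs)"
proof (induction w as bs rule: crossout_run.induct)
  case (1 w)
  then show ?case by (simp add: crossout_marks.simps)
next
  case (2 w a as b bs)
  let ?Y = "set as \<union> set bs"
  let ?X = "set (a # as) \<union> set (b # bs)"
  have b_min: "\<forall>x \<in> insert a ?Y. w b < w x" and a_min: "\<forall>x \<in> ?Y. a < x"
    and run: "crossout_run w as bs"
    using 2 by auto
  have notin: "a \<notin> ?Y" "b \<notin> ?Y" "a \<noteq> b" using a_min b_min by auto
  have "finite ?X" "?X \<noteq> {}" by auto
  then have "arg_min_on w ?X \<in> ?X" "\<not> (\<exists>x\<in>?X. w x < w (arg_min_on w ?X))"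
    by (rule arg_min_if_finite)+
  then have b: "arg_min_on w ?X = b" using b_min by auto
  have "?X - {b} = insert a ?Y" using notin by auto
  moreover have "Min (insert a ?Y) = a" using a_min by (intro Min_eqI) (auto intro: less_imp_le)
  ultimately have a: "Min (?X - {b}) = a" by simp
  have Y: "?X - {b} - {a} = ?Y" using notin by auto
  show ?case
    unfolding crossout_marks.simps[of w ?X] Let_def b a Y using 2 run by simp
qed auto

lemma crossout_run_exists:
  assumes "finite X" "even (card X)" "inj_on w X"
  shows "\<exists>as bs. crossout_run w as bs \<and> set as \<union> set bs = X"
  using assms
proof (induction "card X" arbitrary: X rule: less_induct)
  case less
  show ?case
  proof (cases "X = {}")
    case True
    then have "crossout_run w [] [] \<and> set [] \<union> set [] = X" by simp
    then show ?thesis by blast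
  next
    case False
    define b where "b = arg_min_on w X"
    have b: "b \<in> X" "\<not> (\<exists>x\<in>X. w x < w b)"
      unfolding b_def using arg_min_if_finite[OF less.prems(1) False] by auto
    have b_min: "w b < w x" if "x \<in> X" "x \<noteq> b" for x
      using b that less.prems(3) by (metis inj_on_eq_iff nat_neq_iff)
    \<comment> \<open>Parity guarantees that a position is left for the mark A.\<close>
    have "card X \<noteq> 1" using less.prems(2) by auto
    then have "X \<noteq> {b}" by auto
    then have ne: "X - {b} \<noteq> {}" using b by blast
    define a where "a = Min (X - {b})"
    have a: "a \<in> X" "a \<noteq> b" using Min_in[of "X - {b}"] ne less.prems by (auto simp: a_def)
    have a_min: "a < x" if "x \<in> X - {b} - {a}" for x
      using that Min_le[of "X - {b}" x] less.prems(1) by (fastforce simp: a_def)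
    let ?Y = "X - {b} - {a}"
    have card: "card X = card ?Y + 2"
      using a b less.prems(1) card_Suc_Diff1[of X b] card_Suc_Diff1[of "X - {b}" a] by simp
    have "\<exists>as bs. crossout_run w as bs \<and> set as \<union> set bs = ?Y"
      using less.prems card by (intro less.hyps) (auto intro: inj_on_subset)
    then obtain as bs where run: "crossout_run w as bs" "set as \<union> set bs = ?Y" by blast
    have "crossout_run w (a # as) (b # bs)"
      using run(1) a b_min a_min by (auto simp: run(2))
    moreover have "set (a # as) \<union> set (b # bs) = X" using run(2) a b by auto
    ultimately show ?thesis by blast
  qed
qed

text \<open>Minimality against all later entries follows from comparisons within a round and between
  consecutive rounds, by the chains \<open>w b < w (bs ! j) < w (as ! j)\<close> for values, and for
  positions from \<open>a\<close> through the A-position of the preceding round to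
  \<open>bs ! j\<close>.\<close>

lemma crossout_run_iff:
  assumes "length as = length bs"
  shows "crossout_run w as bs \<longleftrightarrow>
    sorted_wrt (<) as \<and> sorted_wrt (<) (map w bs) \<and>
    (\<forall>j<length as. w (bs ! j) < w (as ! j)) \<and>
    (\<forall>j. Suc j < length as \<longrightarrow> as ! j < bs ! Suc j)"
  using assms
proof (induction as bs rule: list_induct2)
  case Nil
  then show ?case by simp
next
  case (Cons a as b bs)
  show ?case (is "?L \<longleftrightarrow> ?R")
  proof
    assume L: ?L
    then have IH: "sorted_wrt (<) as" "sorted_wrt (<) (map w bs)"
      "\<forall>j<length as. w (bs ! j) < w (as ! j)"
      "\<forall>j. Suc j < length as \<longrightarrow> as ! j < bs ! Suc j"
      using Cons by auto
    have "w ((b # bs) ! j) < w ((a # as) ! j)" if "j < length (a # as)" for j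
      using that IH(3) L by (cases j) auto
    moreover have "(a # as) ! j < (b # bs) ! Suc j" if "Suc j < length (a # as)" for j
      using that IH(4) L Cons.hyps by (cases j) auto
    ultimately show ?R using L IH by auto
  next
    assume R: ?R
    have lt: "w (bs ! j) < w (as ! j)" if "j < length as" for j
      using R that by (metis Suc_less_eq length_Cons nth_Cons_Suc)
    have next_lt: "as ! j < bs ! Suc j" if "Suc j < length as" for j
      using R that by (metis Suc_less_eq length_Cons nth_Cons_Suc)
    have "crossout_run w as bs" using Cons.IH R lt next_lt by simp
    moreover have "w b < w x" if "x \<in> insert a (set as \<union> set bs)" for x
    proof -
      have "w b < w x" if x: "x \<in> set as" for x
      proof -
        obtain j where j: "j < length as" "x = as ! j" using x by (metis in_set_conv_nth)
        have "w b < w (bs ! j)" using R j Cons.hyps by auto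
        also have "\<dots> < w x" using lt j by simp
        finally show ?thesis .
      qed
      moreover have "w b < w a" using R by auto
      moreover have "\<forall>x\<in>set bs. w b < w x" using R by simp
      ultimately show ?thesis using that by blast
    qed
    moreover have "a < x" if x: "x \<in> set bs" for x
    proof -
      obtain j where j: "j < length bs" "x = bs ! j" using x by (metis in_set_conv_nth)
      have a_next: "(a # as) ! j < (b # bs) ! Suc j" using R j Cons.hyps by simp
      have "a \<le> (a # as) ! j" using R j Cons.hyps by (cases j) (auto intro!: less_imp_le)
      with a_next j show ?thesis by simp
    qed
    ultimately show ?L using R by auto
  qed
qed

section \<open>Independent sequences of values at A and positions marked B\<close>

definition values_A :: "nat \<Rightarrow> (nat \<Rightarrow> nat) \<Rightarrow> nat list" where
  "values_A n w = map w (sorted_list_of_set (crossout_A n w))"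

definition positions_B :: "nat \<Rightarrow> (nat \<Rightarrow> nat) \<Rightarrow> nat list" where
  "positions_B n w = sort_key w (sorted_list_of_set (crossout_B n w))"

text \<open>If \<open>S\<close> holds the values at A, the complement holds the values at B; if
  \<open>S\<close> holds the positions marked B, it holds those marked A. These are the counts
  \<open>u\<close> and \<open>u'\<close> of the overview.\<close>

definition compl_below :: "nat \<Rightarrow> nat set \<Rightarrow> nat \<Rightarrow> nat" where
  "compl_below n S x = card {v \<in> {1..2 * n} - S. v < x}"

text \<open>The values at the positions marked A and the positions marked B, in the order of marking,
  range independently over the following two sets.\<close>

definition seqs_A :: "nat \<Rightarrow> nat list set" where
  "seqs_A n = {xs. distinct xs \<and> length xs = n \<and> set xs \<subseteq> {1..2 * n} \<and>
     (\<forall>i<n. i < compl_below n (set xs) (xs ! i))}"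

definition seqs_B :: "nat \<Rightarrow> nat list set" where
  "seqs_B n = {xs. distinct xs \<and> length xs = n \<and> set xs \<subseteq> {1..2 * n} \<and>
     (\<forall>i<n. i \<le> compl_below n (set xs) (xs ! i))}"

text \<open>A run lists the A-positions increasingly and the B-positions by increasing value, so
  sorting the two marked sets recovers its lists.\<close>

lemma crossout_run_unique:
  assumes w: "w permutes {1..2 * n}"
    and run: "crossout_run w as bs" and X: "set as \<union> set bs = {1..2 * n}"
  shows "crossout_A n w = set as" "crossout_B n w = set bs"
    "sorted_list_of_set (crossout_A n w) = as" "values_A n w = map w as" "positions_B n w = bs"
    "length as = n" "length bs = n"
proof -
  show A: "crossout_A n w = set as" and B: "crossout_B n w = set bs"
    using crossout_marks_run[OF run] X by (simp_all add: crossout_A_def crossout_B_def)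
  have len: "length as = length bs" and dist: "distinct (as @ bs)"
    using run crossout_run_length crossout_run_distinct by blast+
  have "length (as @ bs) = card (set (as @ bs))" using dist by (simp only: distinct_card)
  also have "\<dots> = 2 * n" by (simp add: X)
  finally show "length as = n" "length bs = n" using len by simp_all
  have sorted: "sorted_wrt (<) as" "sorted_wrt (<) (map w bs)"
    using crossout_run_iff[OF len] run by blast+
  show srt: "sorted_list_of_set (crossout_A n w) = as"
    using sorted dist unfolding A
    by (simp add: sorted_list_of_set.idem_if_sorted_distinct strict_sorted_iff)
  then show "values_A n w = map w as" by (simp add: values_A_def)
  have "mset (sorted_list_of_set (set bs)) = mset bs"
    using dist by (simp add: set_eq_iff_mset_eq_distinct[symmetric])
  moreover have "inj_on w (set (sorted_list_of_set (set bs)))"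
    using permutes_inj_on[OF w] by blast
  ultimately show "positions_B n w = bs"
    unfolding positions_B_def B using sorted
    by (intro sort_key_inj_key_eq) (auto simp: strict_sorted_iff)
qed

lemma permutes_crossout_run:
  assumes "w permutes {1..2 * n}"
  obtains as bs where "crossout_run w as bs" "set as \<union> set bs = {1..2 * n}"
  using crossout_run_exists[of "{1..2 * n}" w] permutes_inj_on[OF assms] by auto

lemma eq_sorted_list_of_set:
  assumes "sorted_wrt (<) xs" "set xs = S"
  shows "xs = sorted_list_of_set S"
  using assms sorted_list_of_set.idem_if_sorted_distinct[of xs] by (simp add: strict_sorted_iff)

text \<open>The marks partition the positions and \<open>w\<close> partitions the values
  accordingly. Since \<open>as\<close> and \<open>map w bs\<close> are increasing, each is recovered
  from its range; thus \<open>bs\<close> and \<open>map w as\<close> determine the whole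
  run.\<close>

lemma crossout_run_complements:
  assumes w: "w permutes {1..2 * n}"
    and run: "crossout_run w as bs" and X: "set as \<union> set bs = {1..2 * n}"
  shows "as = sorted_list_of_set ({1..2 * n} - set bs)"
    "map w bs = sorted_list_of_set ({1..2 * n} - set (map w as))"
proof -
  have len: "length as = length bs" and dist: "distinct (as @ bs)"
    using run crossout_run_length crossout_run_distinct by blast+
  have sorted: "sorted_wrt (<) as" "sorted_wrt (<) (map w bs)"
    using crossout_run_iff[OF len] run by blast+
  have disj: "set as \<inter> set bs = {}" using dist by auto
  show "as = sorted_list_of_set ({1..2 * n} - set bs)"
    using X disj sorted by (intro eq_sorted_list_of_set) auto
  have "w ` set as \<union> w ` set bs = {1..2 * n}"
    using permutes_image[OF w] X by (metis image_Un)
  moreover have "w ` set as \<inter> w ` set bs = {}"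
    using disj permutes_inj[OF w] by (metis image_Int image_empty)
  ultimately have "w ` set bs = {1..2 * n} - w ` set as" by blast
  then show "map w bs = sorted_list_of_set ({1..2 * n} - set (map w as))"
    using sorted by (intro eq_sorted_list_of_set) auto
qed

lemma card_complement:
  assumes "distinct xs" "length xs = n" "set xs \<subseteq> {1..2 * n}"
  shows "card ({1..2 * n} - set xs) = n"
  using assms distinct_card[of xs] by (simp add: card_Diff_subset)

text \<open>Here the conditions on a run decouple: one compares \<open>map w as\<close> with its own
  sorted complement, the other compares \<open>bs\<close> with its own.\<close>

lemma crossout_run_iff_compl_below:
  assumes as: "as = sorted_list_of_set ({1..2 * n} - set bs)"
    and beta: "map w bs = sorted_list_of_set ({1..2 * n} - set (map w as))"
    and bs: "distinct bs" "length bs = n" "set bs \<subseteq> {1..2 * n}"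
    and alpha: "distinct (map w as)" "length as = n" "set (map w as) \<subseteq> {1..2 * n}"
  shows "crossout_run w as bs \<longleftrightarrow>
    (\<forall>i<n. i < compl_below n (set (map w as)) (map w as ! i)) \<and>
    (\<forall>i<n. i \<le> compl_below n (set bs) (bs ! i))"
proof -
  have len: "length as = length bs" using bs alpha by simp
  have sorted: "sorted_wrt (<) as" "sorted_wrt (<) (map w bs)"
    using as beta by simp_all
  have 1: "w (bs ! j) < w (as ! j) \<longleftrightarrow> j < compl_below n (set (map w as)) (map w as ! j)"
    if "j < n" for j
  proof -
    have "w (bs ! j) < w (as ! j) \<longleftrightarrow> map w bs ! j < map w as ! j"
      using that bs alpha by simp
    also have "\<dots> \<longleftrightarrow> j < compl_below n (set (map w as)) (map w as ! j)"
      unfolding beta compl_below_def using that card_complement[of "map w as" n] alpha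
      by (intro sorted_nth_less_iff) auto
    finally show ?thesis .
  qed
  have 2: "as ! j < bs ! Suc j \<longleftrightarrow> Suc j \<le> compl_below n (set bs) (bs ! Suc j)"
    if "Suc j < n" for j
  proof -
    have "as ! j < bs ! Suc j \<longleftrightarrow> j < compl_below n (set bs) (bs ! Suc j)"
      unfolding as compl_below_def using that card_complement[OF bs]
      by (intro sorted_nth_less_iff) auto
    then show ?thesis by auto
  qed
  \<comment> \<open>The comparison of \<open>as ! j\<close> with \<open>bs ! Suc j\<close> bounds
    index \<open>Suc j\<close>, hence the non-strict inequality; at index 0 it holds
    trivially.\<close>
  have "(\<forall>j. Suc j < n \<longrightarrow> as ! j < bs ! Suc j) \<longleftrightarrow> (\<forall>i<n. i \<le> compl_below n (set bs) (bs ! i))"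
    using 2 by (metis not0_implies_Suc zero_le)
  then show ?thesis
    unfolding crossout_run_iff[OF len] alpha(2) using sorted 1 by auto
qed

lemma ex_permutes_map:
  assumes "distinct xs" "distinct ys" "set xs = X" "set ys = X"
  shows "\<exists>w. w permutes X \<and> map w xs = ys"
proof -
  have len: "length xs = length ys" using assms by (metis distinct_card)
  define w where "w x = (if x \<in> X then the (map_of (zip xs ys) x) else x)" for x
  have map: "map w xs = ys"
  proof (rule nth_equalityI)
    fix i assume "i < length (map w xs)"
    then show "map w xs ! i = ys ! i"
      using assms len nth_mem[of i xs] by (simp add: w_def map_of_zip_nth)
  qed (simp add: len)
  have "bij_betw w X X"
    using map assms by (metis bij_betw_def distinct_map image_set)
  then have "w permutes X"
    by (rule bij_imp_permutes) (simp add: w_def)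
  with map show ?thesis by blast
qed

lemma bij_betw_values_positions:
  "bij_betw (\<lambda>w. (values_A n w, positions_B n w)) {w. w permutes {1..2 * n}} (seqs_A n \<times> seqs_B n)"
proof (rule bij_betwI')
  fix w w' assume "w \<in> {w. w permutes {1..2 * n}}" "w' \<in> {w. w permutes {1..2 * n}}"
  then have w: "w permutes {1..2 * n}" and w': "w' permutes {1..2 * n}" by auto
  obtain as bs where run: "crossout_run w as bs" and X: "set as \<union> set bs = {1..2 * n}"
    using permutes_crossout_run[OF w] by blast
  obtain as' bs' where run': "crossout_run w' as' bs'" and X': "set as' \<union> set bs' = {1..2 * n}"
    using permutes_crossout_run[OF w'] by blast
  have "w = w'"
    if "(values_A n w, positions_B n w) = (values_A n w', positions_B n w')"
  proof -
    from that have bs: "bs = bs'" and alpha: "map w as = map w' as'"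
      using crossout_run_unique[OF w run X] crossout_run_unique[OF w' run' X'] by simp_all
    have as: "as = as'"
      using crossout_run_complements(1)[OF w run X] crossout_run_complements(1)[OF w' run' X'] bs by simp
    have "map w bs = map w' bs'"
      using crossout_run_complements(2)[OF w run X] crossout_run_complements(2)[OF w' run' X'] alpha by simp
    then have "\<forall>x\<in>{1..2 * n}. w x = w' x"
      using alpha unfolding as bs X'[symmetric] by auto
    then show "w = w'"
      using permutes_not_in[OF w] permutes_not_in[OF w'] by (intro ext) metis
  qed
  then show "((values_A n w, positions_B n w) = (values_A n w', positions_B n w')) = (w = w')"
    by blast
next
  fix w assume "w \<in> {w. w permutes {1..2 * n}}"
  then have w: "w permutes {1..2 * n}" by simp
  obtain as bs where run: "crossout_run w as bs" and X: "set as \<union> set bs = {1..2 * n}"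
    using permutes_crossout_run[OF w] by blast
  note uniq = crossout_run_unique[OF w run X] and compls = crossout_run_complements[OF w run X]
  have dist: "distinct as" "distinct bs" using crossout_run_distinct[OF run] by auto
  have bs: "set bs \<subseteq> {1..2 * n}" using X by auto
  have alpha: "distinct (map w as)" "set (map w as) \<subseteq> {1..2 * n}"
  proof -
    show "distinct (map w as)" using dist permutes_inj_on[OF w] by (simp add: distinct_map)
    have "w ` set as \<subseteq> w ` {1..2 * n}" using X by blast
    then show "set (map w as) \<subseteq> {1..2 * n}" using permutes_image[OF w] by simp
  qed
  show "(values_A n w, positions_B n w) \<in> seqs_A n \<times> seqs_B n"
    using crossout_run_iff_compl_below[OF compls dist(2) uniq(7) bs alpha(1) uniq(6) alpha(2)]
      run dist bs alpha uniq
    by (simp add: seqs_A_def seqs_B_def)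
next
  fix p assume "p \<in> seqs_A n \<times> seqs_B n"
  then obtain xs bs where p: "p = (xs, bs)" "xs \<in> seqs_A n" "bs \<in> seqs_B n" by blast
  have xs: "distinct xs" "length xs = n" "set xs \<subseteq> {1..2 * n}"
    "\<forall>i<n. i < compl_below n (set xs) (xs ! i)"
    using p by (auto simp: seqs_A_def)
  have bs: "distinct bs" "length bs = n" "set bs \<subseteq> {1..2 * n}"
    "\<forall>i<n. i \<le> compl_below n (set bs) (bs ! i)"
    using p by (auto simp: seqs_B_def)
  \<comment> \<open>By \<open>crossout_run_complements\<close> these are the only possible
    A-positions and B-values; \<open>w\<close> then has to send \<open>as\<close> to
    \<open>xs\<close> and \<open>bs\<close> to \<open>ys\<close>.\<close>
  define as where "as = sorted_list_of_set ({1..2 * n} - set bs)"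
  define ys where "ys = sorted_list_of_set ({1..2 * n} - set xs)"
  have as: "distinct as" "set as = {1..2 * n} - set bs" "length as = n"
    using card_complement[OF bs(1-3)] by (simp_all add: as_def)
  have ys: "distinct ys" "set ys = {1..2 * n} - set xs" "length ys = n"
    using card_complement[OF xs(1-3)] by (simp_all add: ys_def)
  have "\<exists>w. w permutes {1..2 * n} \<and> map w (as @ bs) = xs @ ys"
    using as ys xs bs by (intro ex_permutes_map) auto
  then obtain w where w: "w permutes {1..2 * n}" and map: "map w as = xs" "map w bs = ys"
    using as xs by auto
  have "crossout_run w as bs"
    using as_def ys_def as(3) xs bs map
    by (intro iffD2[OF crossout_run_iff_compl_below[of as n bs w]]) simp_all
  moreover have "set as \<union> set bs = {1..2 * n}" using as(2) bs(3) by blast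
  ultimately have "p = (values_A n w, positions_B n w)"
    using crossout_run_unique(4,5)[OF w] map p(1) by simp
  with w show "\<exists>w\<in>{w. w permutes {1..2 * n}}. p = (values_A n w, positions_B n w)" by blast
qed

section \<open>Labelled Dyck paths\<close>

lemma path_height_0 [simp]: "path_height p 0 = 0"
  by (simp add: path_height_def)

lemma path_height_Suc:
  "k < length p \<Longrightarrow> path_height p (Suc k) = path_height p k + step_value (p ! k)"
  by (simp add: path_height_def take_Suc_conv_app_nth)

lemma finite_down_steps [simp]: "finite (down_steps p)"
  by (simp add: down_steps_def)

lemma length_path_with_down_steps [simp]: "length (path_with_down_steps N S) = 2 * N"
  by (simp add: path_with_down_steps_def)

lemma nth_path_with_down_steps:
  "k < 2 * N \<Longrightarrow> path_with_down_steps N S ! k = (if Suc k \<in> S then Down else Up)"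
  by (simp add: path_with_down_steps_def del: upt_Suc)

lemma down_steps_path_with_down_steps:
  "S \<subseteq> {1..2 * N} \<Longrightarrow> down_steps (path_with_down_steps N S) = S"
  by (fastforce simp: down_steps_def nth_path_with_down_steps split: if_splits)

lemma path_with_down_steps_down_steps:
  "length p = 2 * N \<Longrightarrow> path_with_down_steps N (down_steps p) = p"
  by (rule nth_equalityI)
    (auto simp: nth_path_with_down_steps down_steps_def, metis step.exhaust)

lemma path_height_card:
  assumes "k \<le> length p"
  shows "path_height p k =
    int (card {v \<in> {1..k}. v \<notin> down_steps p}) - int (card {v \<in> {1..k}. v \<in> down_steps p})"
  using assms
proof (induction k)
  case 0
  then show ?case by simp
next
  case (Suc k)
  have card_Suc: "card {v \<in> {1..Suc k}. P v} =
      card {v \<in> {1..k}. P v} + (if P (Suc k) then 1 else 0)" for P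
  proof (cases "P (Suc k)")
    case True
    then have "{v \<in> {1..Suc k}. P v} = insert (Suc k) {v \<in> {1..k}. P v}"
      by (auto simp: le_Suc_eq)
    then show ?thesis using True by simp
  next
    case False
    then have "{v \<in> {1..Suc k}. P v} = {v \<in> {1..k}. P v}"
      by (auto simp: le_Suc_eq)
    then show ?thesis using False by simp
  qed
  have "Suc k \<in> down_steps p \<longleftrightarrow> p ! k = Down"
    using Suc.prems by (simp add: down_steps_def)
  then show ?case
    using Suc path_height_Suc[of k p] unfolding card_Suc by (cases "p ! k") auto
qed

lemma path_height_length:
  "path_height p (length p) = int (length p) - 2 * int (card (down_steps p))"
proof -
  have down: "{v \<in> {1..length p}. v \<in> down_steps p} = down_steps p"
    by (auto simp: down_steps_def)
  have "{v \<in> {1..length p}. v \<notin> down_steps p} = {1..length p} - down_steps p" by auto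
  moreover have sub: "down_steps p \<subseteq> {1..length p}" by (auto simp: down_steps_def)
  ultimately have "card {v \<in> {1..length p}. v \<notin> down_steps p} = length p - card (down_steps p)"
    by (simp add: card_Diff_subset)
  moreover have "card (down_steps p) \<le> length p"
    using card_mono[OF _ sub] by simp
  ultimately show ?thesis
    using path_height_card[of "length p" p] down by simp
qed

text \<open>A path can only drop below the axis along a down step, so positive starting heights of
  the down steps suffice; having \<open>N\<close> of them brings the path back to height 0.\<close>

lemma dyck_pathI:
  assumes len: "length p = 2 * N" and card: "card (down_steps p) = N"
    and pos: "\<And>k. k < N \<Longrightarrow> 1 \<le> down_height p (Suc k)"
  shows "dyck_path N p"
proof -
  have "0 \<le> path_height p k" if "k \<le> 2 * N" for k
    using that
  proof (induction k)
    case 0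
    then show ?case by simp
  next
    case (Suc k)
    show ?case
    proof (cases "p ! k")
      case Up
      then show ?thesis using Suc len by (simp add: path_height_Suc)
    next
      case Down
      then have "Suc k \<in> set (sorted_list_of_set (down_steps p))"
        using Suc.prems len by (simp add: down_steps_def)
      then obtain i where "i < N" "sorted_list_of_set (down_steps p) ! i = Suc k"
        using card by (metis in_set_conv_nth sorted_list_of_set.length_sorted_key_list_of_set)
      then have "1 \<le> path_height p k"
        using pos[of i] by (simp add: down_height_def nth_down_step_def)
      then show ?thesis using Down Suc.prems len by (simp add: path_height_Suc)
    qed
  qed
  moreover have "path_height p (2 * N) = 0"
    using path_height_length[of p] len card by simp
  ultimately show ?thesis using len by (simp add: dyck_path_def)
qed

lemma dyck_path_card: "dyck_path N p \<Longrightarrow> card (down_steps p) = N"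
  using path_height_length[of p] by (simp add: dyck_path_def)

text \<open>Bijections on the fibers of \<open>b\<close> are glued together, with \<open>P\<close>
  recording the fiber. It is applied with \<open>b = set\<close>: the path records the range of a
  sequence and the labels record its order.\<close>

lemma bij_betw_fibers:
  assumes inj: "inj_on P G" and bij: "\<And>S. S \<in> G \<Longrightarrow> bij_betw f (X S) (Y S)"
    and base: "\<And>S x. S \<in> G \<Longrightarrow> x \<in> X S \<Longrightarrow> b x = S"
  shows "bij_betw (\<lambda>x. (P (b x), f x)) (\<Union>S\<in>G. X S) {(p, y). \<exists>S\<in>G. p = P S \<and> y \<in> Y S}"
proof (rule bij_betwI')
  fix x x' assume "x \<in> (\<Union>S\<in>G. X S)" "x' \<in> (\<Union>S\<in>G. X S)"
  then obtain S S' where S: "S \<in> G" "x \<in> X S" "S' \<in> G" "x' \<in> X S'" by blast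
  have "x = x'" if "P (b x) = P (b x')" "f x = f x'"
  proof -
    have "S = S'" using that(1) S base inj by (metis inj_onD)
    then show ?thesis
      using that(2) S bij[OF S(1)] by (metis bij_betw_imp_inj_on inj_onD)
  qed
  then show "((P (b x), f x) = (P (b x'), f x')) = (x = x')" by auto
next
  fix x assume "x \<in> (\<Union>S\<in>G. X S)"
  then obtain S where S: "S \<in> G" "x \<in> X S" by blast
  then show "(P (b x), f x) \<in> {(p, y). \<exists>S\<in>G. p = P S \<and> y \<in> Y S}"
    using base[OF S] bij_betwE[OF bij[OF S(1)]] by auto
next
  fix q assume "q \<in> {(p, y). \<exists>S\<in>G. p = P S \<and> y \<in> Y S}"
  then obtain S y where S: "S \<in> G" "q = (P S, y)" "y \<in> Y S" by blast
  then obtain x where "x \<in> X S" "f x = y"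
    using bij[OF S(1)] by (metis bij_betw_imp_surj_on imageE)
  then show "\<exists>x\<in>\<Union>S\<in>G. X S. q = (P (b x), f x)"
    using S base by blast
qed

section \<open>Histories of the values at A\<close>

definition half_subsets :: "nat \<Rightarrow> nat set set" where
  "half_subsets n = {S. S \<subseteq> {1..2 * n} \<and> card S = n}"

lemma half_subsetsD:
  assumes "S \<in> half_subsets n"
  shows "S \<subseteq> {1..2 * n}" "card S = n" "finite S" "card ({1..2 * n} - S) = n"
proof -
  show S: "S \<subseteq> {1..2 * n}" "card S = n" using assms by (auto simp: half_subsets_def)
  then show "finite S" using finite_subset by blast
  then show "card ({1..2 * n} - S) = n" using S by (simp add: card_Diff_subset)
qed

lemma nth_half_subset:
  assumes "S \<in> half_subsets n" "k < n"
  shows "sorted_list_of_set S ! k \<in> S"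
  using half_subsetsD[OF assms(1)] assms(2)
  by (metis nth_mem set_sorted_list_of_set sorted_list_of_set.length_sorted_key_list_of_set)

lemma compl_below_mono: "s \<le> t \<Longrightarrow> compl_below n S s \<le> compl_below n S t"
  unfolding compl_below_def by (intro card_mono) auto

lemma compl_below_le: "S \<in> half_subsets n \<Longrightarrow> compl_below n S s \<le> n"
  using half_subsetsD(4)[of S n] card_mono[of "{1..2 * n} - S" "{v \<in> {1..2 * n} - S. v < s}"]
  unfolding compl_below_def by fastforce

text \<open>These labelled Dyck paths are known as Hermite histories.\<close>

definition histories_A :: "nat \<Rightarrow> (step list \<times> int list) set" where
  "histories_A n = {(p, ls). dyck_path n p \<and> length ls = n \<and>
     (\<forall>i\<in>{1..n}. 1 \<le> ls ! (i - 1) \<and> ls ! (i - 1) \<le> down_height p i)}"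

definition histories_B :: "nat \<Rightarrow> (step list \<times> int list) set" where
  "histories_B n = {(p, ms). dyck_path (n + 1) p \<and> length ms = n \<and>
     (\<forall>i\<in>{1..n}. 1 \<le> ms ! (i - 1) \<and> ms ! (i - 1) \<le> down_height_star p i)}"

lemma ball_1_n_iff: "(\<forall>i\<in>{1..n}. P i) \<longleftrightarrow> (\<forall>k<n. P (Suc k))"
  by (metis One_nat_def Suc_le_eq Suc_pred atLeastAtMost_iff le_simps(2) not_gr0 order.refl zero_less_Suc)

text \<open>Before the down step at \<open>s\<close>, the up steps are the elements of the
  complement below \<open>s\<close>, and the down steps are the \<open>k\<close> elements of
  \<open>S\<close> below \<open>s\<close>.\<close>

lemma down_height_A:
  assumes S: "S \<in> half_subsets n" and k: "k < n"
  shows "down_height (path_with_down_steps n S) (Suc k)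
    = int (compl_below n S (sorted_list_of_set S ! k)) - int k"
proof -
  let ?s = "sorted_list_of_set S ! k" and ?p = "path_with_down_steps n S"
  note S' = half_subsetsD[OF S]
  have D: "down_steps ?p = S" using S' by (simp add: down_steps_path_with_down_steps)
  have s: "?s \<in> S" "1 \<le> ?s" "?s \<le> 2 * n" using nth_half_subset[OF S k] S'(1) by auto
  have up: "{v \<in> {1..?s - 1}. v \<notin> S} = {v \<in> {1..2 * n} - S. v < ?s}" using s by auto
  have down: "{v \<in> {1..?s - 1}. v \<in> S} = {v \<in> S. v < ?s}" using s S'(1) by auto
  have "path_height ?p (?s - 1) = int (compl_below n S ?s) - int k"
    using s path_height_card[of "?s - 1" ?p] card_below_sorted_nth[OF S'(3), of k] k S'(2)
    by (simp only: D up down compl_below_def length_path_with_down_steps)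
  then show ?thesis by (simp add: down_height_def nth_down_step_def D)
qed

lemma bij_betw_seqs_A:
  "bij_betw (\<lambda>xs. (path_with_down_steps n (set xs), inv_labels xs)) (seqs_A n) (histories_A n)"
proof -
  let ?G = "half_subsets n" and ?P = "path_with_down_steps n"
  let ?U = "compl_below n"
  let ?X = "\<lambda>S. {xs. distinct xs \<and> set xs = S \<and> (\<forall>i<card S. i < ?U S (xs ! i))}"
  let ?Y = "\<lambda>S. {ls. length ls = card S \<and> (\<forall>k<card S. 1 \<le> ls ! k \<and>
        ls ! k \<le> int (?U S (sorted_list_of_set S ! k)) - int k)}"
  have inj: "inj_on ?P ?G"
    by (rule inj_on_inverseI[where g = down_steps])
      (simp add: down_steps_path_with_down_steps half_subsets_def)
  have bij: "bij_betw inv_labels (?X S) (?Y S)" if "S \<in> ?G" for S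
    using half_subsetsD[OF that] compl_below_le[OF that] compl_below_mono
    by (intro bij_betw_inv_labels) auto
  have "bij_betw (\<lambda>xs. (?P (set xs), inv_labels xs)) (\<Union>S\<in>?G. ?X S)
      {(p, ls). \<exists>S\<in>?G. p = ?P S \<and> ls \<in> ?Y S}"
    by (rule bij_betw_fibers[OF inj bij]) auto
  moreover have "(\<Union>S\<in>?G. ?X S) = seqs_A n"
  proof -
    have "card (set xs) = n \<longleftrightarrow> length xs = n" if "distinct xs" for xs :: "nat list"
      using that by (simp add: distinct_card)
    then show ?thesis by (auto simp: seqs_A_def half_subsets_def)
  qed
  moreover have "{(p, ls). \<exists>S\<in>?G. p = ?P S \<and> ls \<in> ?Y S} = histories_A n"
  proof -
    have iff: "ls \<in> ?Y S \<longleftrightarrow> (?P S, ls) \<in> histories_A n" if S: "S \<in> ?G" for S ls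
    proof -
      note S' = half_subsetsD[OF S]
      have D: "down_steps (?P S) = S" using S' by (simp add: down_steps_path_with_down_steps)
      \<comment> \<open>The existence of labels already forces the Dyck property: a label between 1
        and the height makes that height positive.\<close>
      have "dyck_path n (?P S)" if "ls \<in> ?Y S"
      proof (rule dyck_pathI)
        fix k assume k: "k < n"
        then have "1 \<le> ls ! k" "ls ! k \<le> int (?U S (sorted_list_of_set S ! k)) - int k"
          using that S' by auto
        then show "1 \<le> down_height (?P S) (Suc k)"
          unfolding down_height_A[OF S k] by linarith
      qed (use D S' in auto)
      then show ?thesis
        unfolding histories_A_def ball_1_n_iff using S' by (auto simp: down_height_A[OF S])
    qed
    have "\<exists>S\<in>?G. p = ?P S" if "(p, ls) \<in> histories_A n" for p ls
    proof -
      have p: "dyck_path n p" using that by (simp add: histories_A_def)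
      then have len: "length p = 2 * n" by (simp add: dyck_path_def)
      have "down_steps p \<in> ?G"
        using dyck_path_card[OF p] len by (auto simp: half_subsets_def down_steps_def)
      moreover have "p = ?P (down_steps p)" using path_with_down_steps_down_steps[OF len] by simp
      ultimately show ?thesis by blast
    qed
    with iff show ?thesis by blast
  qed
  ultimately show ?thesis by simp
qed

section \<open>Histories of the positions marked B\<close>

definition down_set_B :: "nat \<Rightarrow> nat set \<Rightarrow> nat set" where
  "down_set_B n S = Suc ` S \<union> {2 * n + 2}"

text \<open>With \<open>S\<close> the set of positions marked B, this is
  \<open>path_B\<close>.\<close>

definition path_of_B :: "nat \<Rightarrow> nat set \<Rightarrow> step list" where
  "path_of_B n S = path_with_down_steps (n + 1) (down_set_B n S)"

lemma length_path_of_B [simp]: "length (path_of_B n S) = 2 * n + 2"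
  by (simp add: path_of_B_def)

lemma nth_path_of_B:
  "k < 2 * n + 2 \<Longrightarrow> path_of_B n S ! k = (if Suc k \<in> down_set_B n S then Down else Up)"
  unfolding path_of_B_def by (rule nth_path_with_down_steps) simp

lemma down_steps_B:
  assumes S: "S \<in> half_subsets n"
  shows "down_steps (path_of_B n S) = down_set_B n S"
  using half_subsetsD(1)[OF S]
  unfolding path_of_B_def by (intro down_steps_path_with_down_steps) (auto simp: down_set_B_def)

lemma sorted_down_set_B:
  assumes S: "S \<in> half_subsets n"
  shows "sorted_list_of_set (down_set_B n S) = map Suc (sorted_list_of_set S) @ [2 * n + 2]"
proof (rule eq_sorted_list_of_set[symmetric])
  have "x \<le> 2 * n" if "x \<in> S" for x using half_subsetsD(1)[OF S] that by auto
  then show "sorted_wrt (<) (map Suc (sorted_list_of_set S) @ [2 * n + 2])"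
    using half_subsetsD(3)[OF S] by (fastforce simp: sorted_wrt_append sorted_wrt_map)
  show "set (map Suc (sorted_list_of_set S) @ [2 * n + 2]) = down_set_B n S"
    using half_subsetsD(3)[OF S] by (auto simp: down_set_B_def)
qed

lemma nth_down_step_B:
  assumes S: "S \<in> half_subsets n" and k: "k < n"
  shows "nth_down_step (path_of_B n S) (Suc k)
    = Suc (sorted_list_of_set S ! k)"
  using half_subsetsD(2)[OF S] k
  by (simp add: nth_down_step_def down_steps_B[OF S] sorted_down_set_B[OF S] nth_append
      del: add_2_eq_Suc')

text \<open>The shift by 1 puts an additional up step in front, which raises the height found in
  \<open>down_height_A\<close> by 1.\<close>

lemma down_height_B:
  assumes S: "S \<in> half_subsets n" and k: "k < n"
  shows "down_height (path_of_B n S) (Suc k)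
    = 1 + int (compl_below n S (sorted_list_of_set S ! k)) - int k"
proof -
  let ?s = "sorted_list_of_set S ! k" and ?p = "path_of_B n S"
  note S' = half_subsetsD[OF S]
  have s: "?s \<in> S" "1 \<le> ?s" "?s \<le> 2 * n" using nth_half_subset[OF S k] S'(1) by auto
  have up: "{v \<in> {1..?s}. v \<notin> down_set_B n S} = insert 1 (Suc ` {v \<in> {1..2 * n} - S. v < ?s})"
  proof (intro equalityI subsetI)
    fix v assume v: "v \<in> {v \<in> {1..?s}. v \<notin> down_set_B n S}"
    then obtain u where "v = Suc u" by (cases v) auto
    with v s show "v \<in> insert 1 (Suc ` {v \<in> {1..2 * n} - S. v < ?s})"
      by (cases "u = 0") (auto simp: down_set_B_def)
  qed (use s S'(1) in \<open>auto simp: down_set_B_def\<close>)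
  have down: "{v \<in> {1..?s}. v \<in> down_set_B n S} = Suc ` {v \<in> S. v < ?s}"
    using s by (auto simp: down_set_B_def)
  have "card (insert 1 (Suc ` {v \<in> {1..2 * n} - S. v < ?s})) = Suc (compl_below n S ?s)"
    by (subst card_insert_disjoint) (auto simp: compl_below_def card_image)
  moreover have "card (Suc ` {v \<in> S. v < ?s}) = k"
    using card_below_sorted_nth[OF S'(3), of k] k S'(2) by (simp add: card_image)
  ultimately have "path_height ?p ?s = 1 + int (compl_below n S ?s) - int k"
    using s path_height_card[of ?s ?p] unfolding down_steps_B[OF S] up down by simp
  then show ?thesis by (simp add: down_height_def nth_down_step_B[OF S k])
qed

text \<open>A later up step exists iff some element of the complement exceeds \<open>s\<close>, that
  is, iff \<open>compl_below\<close> is less than \<open>n\<close>. Otherwise it equals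
  \<open>n\<close>, and lowering the height by 1 replaces \<open>Suc n\<close> by \<open>n\<close>;
  the minimum covers both cases.\<close>

lemma down_height_star_B:
  assumes S: "S \<in> half_subsets n" and k: "k < n"
  shows "down_height_star (path_of_B n S) (Suc k)
    = int (min n (Suc (compl_below n S (sorted_list_of_set S ! k)))) - int k"
proof -
  let ?s = "sorted_list_of_set S ! k" and ?p = "path_of_B n S"
  note S' = half_subsetsD[OF S]
  have s: "?s \<in> S" using nth_half_subset[OF S k] .
  have "(\<exists>j\<in>{1..length ?p}. nth_down_step ?p (Suc k) < j \<and> ?p ! (j - 1) = Up)
      \<longleftrightarrow> (\<exists>v\<in>{1..2 * n} - S. ?s < v)" (is "?L \<longleftrightarrow> ?R")
  proof
    assume ?L
    then obtain j where j: "j \<in> {1..2 * n + 2}" "Suc ?s < j" "?p ! (j - 1) = Up"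
      by (auto simp: nth_down_step_B[OF S k])
    then have "j \<notin> down_set_B n S"
      by (auto simp: nth_path_of_B split: if_splits)
    moreover obtain v where "j = Suc v" using j(2) by (cases j) auto
    ultimately show ?R using j by (intro bexI[of _ v]) (auto simp: down_set_B_def)
  next
    assume ?R
    then obtain v where v: "v \<in> {1..2 * n} - S" "?s < v" by blast
    then have "Suc v \<notin> down_set_B n S" by (auto simp: down_set_B_def)
    with v show ?L
      by (intro bexI[of _ "Suc v"]) (auto simp: nth_down_step_B[OF S k] nth_path_of_B)
  qed
  also have "\<dots> \<longleftrightarrow> compl_below n S ?s < n"
  proof
    assume ?R
    then obtain v where "v \<in> {1..2 * n} - S" "\<not> v < ?s" by (meson order.asym)
    then have "{v \<in> {1..2 * n} - S. v < ?s} \<subset> {1..2 * n} - S" by blast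
    then have "compl_below n S ?s < card ({1..2 * n} - S)"
      unfolding compl_below_def by (intro psubset_card_mono) auto
    then show "compl_below n S ?s < n" using S'(4) by simp
  next
    assume "compl_below n S ?s < n"
    then have "card {v \<in> {1..2 * n} - S. v < ?s} \<noteq> card ({1..2 * n} - S)"
      unfolding compl_below_def S'(4) by (rule less_imp_neq)
    then have "{v \<in> {1..2 * n} - S. v < ?s} \<noteq> {1..2 * n} - S" by metis
    then obtain v where "v \<in> {1..2 * n} - S" "\<not> v < ?s" by blast
    then show ?R using s by (metis DiffD2 linorder_neqE_nat)
  qed
  finally show ?thesis
    unfolding down_height_star_def down_height_B[OF S k]
    using compl_below_le[OF S, of ?s] by auto
qed

text \<open>A Dyck path of positive length begins with an up step and ends with a down step.
  Removing both and shifting back leaves \<open>n\<close> down steps among \<open>2 * n\<close>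
  places.\<close>

lemma dyck_path_down_set_B:
  assumes p: "dyck_path (n + 1) p"
  shows "\<exists>S\<in>half_subsets n. p = path_of_B n S"
proof -
  have len: "length p = 2 * n + 2" and end0: "path_height p (2 * n + 2) = 0"
    and ge0: "\<And>k. k \<le> 2 * n + 2 \<Longrightarrow> 0 \<le> path_height p k"
    using p by (auto simp: dyck_path_def)
  define S where "S = {v. v \<le> 2 * n \<and> Suc v \<in> down_steps p}"
  have "p ! 0 \<noteq> Down" using path_height_Suc[of 0 p] ge0[of 1] len by auto
  then have "1 \<notin> down_steps p" by (simp add: down_steps_def)
  then have S1: "S \<subseteq> {1..2 * n}" by (auto simp: S_def Suc_le_eq intro: gr0I)
  have "p ! (2 * n + 1) \<noteq> Up"
    using path_height_Suc[of "2 * n + 1" p] ge0[of "2 * n + 1"] end0 len by auto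
  then have last: "2 * n + 2 \<in> down_steps p"
    using len by (cases "p ! (2 * n + 1)") (auto simp: down_steps_def)
  have D: "down_steps p = down_set_B n S"
  proof (intro equalityI subsetI)
    fix v assume v: "v \<in> down_steps p"
    then have "1 \<le> v" "v \<le> 2 * n + 2" using len by (auto simp: down_steps_def)
    then obtain u where "v = Suc u" "u \<le> 2 * n + 1" by (cases v) auto
    with v show "v \<in> down_set_B n S"
      by (cases "u = 2 * n + 1") (auto simp: down_set_B_def S_def)
  qed (use last in \<open>auto simp: down_set_B_def S_def\<close>)
  have "finite S" using S1 finite_subset by blast
  moreover have "2 * n + 2 \<notin> Suc ` S" using S1 by auto
  ultimately have "card (down_set_B n S) = Suc (card S)"
    by (simp add: down_set_B_def card_image)
  then have "S \<in> half_subsets n"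
    using dyck_path_card[OF p] S1 D by (simp add: half_subsets_def)
  moreover have "p = path_of_B n S"
    using path_with_down_steps_down_steps[of p "n + 1"] len D by (simp add: path_of_B_def)
  ultimately show ?thesis by blast
qed

lemma bij_betw_seqs_B:
  "bij_betw (\<lambda>xs. (path_of_B n (set xs), inv_labels xs))
     (seqs_B n) (histories_B n)"
proof -
  let ?G = "half_subsets n" and ?P = "path_of_B n"
  \<comment> \<open>The successor turns the non-strict bound of \<open>seqs_B\<close> into a strict
    one. Capping at \<open>n\<close> does not affect indices below \<open>n\<close>, keeps
    \<open>U\<close> at most \<open>card S\<close>, and yields exactly the modified height.\<close>
  let ?U = "\<lambda>S s. min n (Suc (compl_below n S s))"
  let ?X = "\<lambda>S. {xs. distinct xs \<and> set xs = S \<and> (\<forall>i<card S. i < ?U S (xs ! i))}"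
  let ?Y = "\<lambda>S. {ls. length ls = card S \<and> (\<forall>k<card S. 1 \<le> ls ! k \<and>
        ls ! k \<le> int (?U S (sorted_list_of_set S ! k)) - int k)}"
  have inj: "inj_on ?P ?G"
  proof (rule inj_on_inverseI[where g = "\<lambda>p. {v. v \<le> 2 * n \<and> Suc v \<in> down_steps p}"])
    fix S assume S: "S \<in> ?G"
    show "{v. v \<le> 2 * n \<and> Suc v \<in> down_steps (?P S)} = S"
      using half_subsetsD(1)[OF S] unfolding down_steps_B[OF S] by (auto simp: down_set_B_def)
  qed
  have bij: "bij_betw inv_labels (?X S) (?Y S)" if "S \<in> ?G" for S
    using half_subsetsD[OF that] compl_below_mono
    by (intro bij_betw_inv_labels) (simp_all add: min.coboundedI2)
  have "bij_betw (\<lambda>xs. (?P (set xs), inv_labels xs)) (\<Union>S\<in>?G. ?X S)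
      {(p, ls). \<exists>S\<in>?G. p = ?P S \<and> ls \<in> ?Y S}"
    by (rule bij_betw_fibers[OF inj bij]) auto
  moreover have "(\<Union>S\<in>?G. ?X S) = seqs_B n"
  proof -
    have "card (set xs) = n \<longleftrightarrow> length xs = n" if "distinct xs" for xs :: "nat list"
      using that by (simp add: distinct_card)
    then show ?thesis by (auto simp: seqs_B_def half_subsets_def less_Suc_eq_le)
  qed
  moreover have "{(p, ls). \<exists>S\<in>?G. p = ?P S \<and> ls \<in> ?Y S} = histories_B n"
  proof -
    have iff: "ls \<in> ?Y S \<longleftrightarrow> (?P S, ls) \<in> histories_B n" if S: "S \<in> ?G" for S ls
    proof -
      note S' = half_subsetsD[OF S]
      have "dyck_path (n + 1) (?P S)" if Y: "ls \<in> ?Y S"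
      proof (rule dyck_pathI)
        have "2 * n + 2 \<notin> Suc ` S" using S'(1) by auto
        then show card: "card (down_steps (?P S)) = n + 1"
          unfolding down_steps_B[OF S] using S' by (simp add: down_set_B_def card_image)
        fix k assume "k < n + 1"
        then consider "k < n" | "k = n" by linarith
        then show "1 \<le> down_height (?P S) (Suc k)"
        proof cases
          case 1
          then have "1 \<le> ls ! k" "ls ! k \<le> int (?U S (sorted_list_of_set S ! k)) - int k"
            using Y S' by auto
          then show ?thesis unfolding down_height_B[OF S 1] by linarith
        next
          case 2
          \<comment> \<open>The last down step carries no label; it starts at height 1 because it
            ends at height 0.\<close>
          have last: "nth_down_step (?P S) (Suc n) = 2 * n + 2"
            using S' by (simp add: nth_down_step_def down_steps_B[OF S] sorted_down_set_B[OF S]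
                nth_append del: add_2_eq_Suc')
          have "path_height (?P S) (2 * n + 2) = 0"
            using path_height_length[of "?P S"] card by simp
          moreover have "?P S ! (2 * n + 1) = Down"
            by (simp add: nth_path_of_B down_set_B_def)
          ultimately have "path_height (?P S) (2 * n + 1) = 1"
            using path_height_Suc[of "2 * n + 1" "?P S"] by simp
          then show ?thesis using last 2 by (simp add: down_height_def)
        qed
      qed simp
      then show ?thesis
        unfolding histories_B_def ball_1_n_iff using S'(2)
        by (auto simp: down_height_star_B[OF S] simp del: of_nat_min)
    qed
    have "\<exists>S\<in>?G. p = ?P S" if "(p, ls) \<in> histories_B n" for p ls
      using that dyck_path_down_set_B by (auto simp: histories_B_def)
    with iff show ?thesis by blast
  qed
  ultimately show ?thesis by simp
qed

section \<open>The labels of a permutation\<close>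

text \<open>This makes the definite descriptions \<open>perm_J\<close> and \<open>perm_K\<close>
  meaningful: the permutation is the inverse of \<open>f\<close> after \<open>g\<close> on
  \<open>I\<close>, and the identity elsewhere.\<close>

lemma ex1_permutes_matching:
  fixes f g :: "'a \<Rightarrow> 'b"
  assumes f: "bij_betw f I S" and g: "bij_betw g I S"
  shows "\<exists>!J. J permutes I \<and> (\<forall>i\<in>I. g i = f (J i))"
proof -
  define J where "J i = (if i \<in> I then inv_into I f (g i) else i)" for i
  have "bij_betw (inv_into I f \<circ> g) I I"
    using bij_betw_trans[OF g bij_betw_inv_into[OF f]] .
  then have "bij_betw J I I"
    by (rule bij_betw_cong[THEN iffD1, rotated]) (simp add: J_def)
  then have J: "J permutes I" by (rule bij_imp_permutes) (simp add: J_def)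
  have J_match: "g i = f (J i)" if "i \<in> I" for i
  proof -
    have "g i \<in> f ` I" using that f g by (metis bij_betw_imp_surj_on imageI)
    then show ?thesis using that by (simp add: J_def f_inv_into_f)
  qed
  show ?thesis
  proof (rule ex1I[of _ J])
    fix K assume K: "K permutes I \<and> (\<forall>i\<in>I. g i = f (K i))"
    show "K = J"
    proof
      fix i
      show "K i = J i"
      proof (cases "i \<in> I")
        case True
        then have "f (K i) = f (J i)" using K J_match by simp
        moreover have "K i \<in> I" "J i \<in> I" using K J True by (simp_all add: permutes_in_image)
        ultimately show ?thesis using f by (metis bij_betw_imp_inj_on inj_onD)
      next
        case False
        then show ?thesis using K J by (metis permutes_not_in)
      qed
    qed
  qed (use J J_match in auto)
qed

lemma bij_betw_nth_pred:
  "distinct xs \<Longrightarrow> length xs = n \<Longrightarrow> bij_betw (\<lambda>i. xs ! (i - 1)) {1..n} (set xs)"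
proof -
  assume xs: "distinct xs" "length xs = n"
  have "bij_betw (\<lambda>i. i - 1) {1..n} {..<n}"
    by (rule bij_betwI[where g = Suc]) auto
  moreover have "bij_betw ((!) xs) {..<n} (set xs)"
    using xs by (intro bij_betw_nth) auto
  ultimately have "bij_betw ((!) xs \<circ> (\<lambda>i. i - 1)) {1..n} (set xs)"
    by (rule bij_betw_trans)
  then show ?thesis by (simp add: comp_def)
qed

text \<open>Since \<open>J\<close> sends a place to the rank of its entry, \<open>inv J k\<close> is
  the place of the \<open>k\<close>-th smallest entry, and the count is the Lehmer code at that
  entry.\<close>

lemma inv_labels_permuted:
  assumes xs: "distinct xs" "length xs = n"
    and J: "J permutes {1..n}"
    and match: "\<And>i. i \<in> {1..n} \<Longrightarrow> xs ! (i - 1) = sorted_list_of_set (set xs) ! (J i - 1)"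
  shows "map (\<lambda>k. 1 + int (card {j \<in> {1..n}. j < inv J k \<and> xs ! (j - 1) > xs ! (inv J k - 1)}))
      [1..<n + 1] = inv_labels xs" (is "?labels = _")
proof (rule nth_equalityI)
  show "length ?labels = length (inv_labels xs)"
    using xs by (simp add: inv_labels_def distinct_card)
next
  fix k assume "k < length ?labels"
  then have k: "k < n" by (simp del: upt_Suc)
  define i where "i = inv J (Suc k)"
  have "i \<in> {1..n}"
    using permutes_in_image[OF permutes_inv[OF J], of "Suc k"] k by (simp add: i_def)
  then obtain i' where i': "i = Suc i'" "i' < n" by (cases i) auto
  have "J i = Suc k" using permutes_inverses(1)[OF J] by (simp add: i_def)
  then have nth: "xs ! i' = sorted_list_of_set (set xs) ! k"
    using match[OF \<open>i \<in> {1..n}\<close>] i' by simp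
  have "{j \<in> {1..n}. j < i \<and> xs ! (j - 1) > xs ! (i - 1)} = Suc ` {j. j < i' \<and> xs ! i' < xs ! j}"
  proof (intro equalityI subsetI)
    fix j assume "j \<in> {j \<in> {1..n}. j < i \<and> xs ! (j - 1) > xs ! (i - 1)}"
    then show "j \<in> Suc ` {j. j < i' \<and> xs ! i' < xs ! j}" using i' by (cases j) auto
  qed (use i' in auto)
  then have "card {j \<in> {1..n}. j < i \<and> xs ! (j - 1) > xs ! (i - 1)} = inv_before xs (xs ! i')"
    using inv_before_nth[of xs i'] xs i' by (simp add: card_image)
  then show "?labels ! k = inv_labels xs ! k"
    using k xs nth by (simp add: inv_labels_def distinct_card i_def del: upt_Suc)
qed

text \<open>The values at A and the down steps of \<open>path_A\<close> enumerate the same set, so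
  \<open>perm_J\<close> has its defining property and \<open>inv_labels_permuted\<close>
  applies.\<close>

lemma labels_A_eq:
  assumes w: "w permutes {1..2 * n}"
  shows "path_A n w = path_with_down_steps n (set (values_A n w))"
    and "labels_A n w = inv_labels (values_A n w)"
proof -
  obtain as bs where run: "crossout_run w as bs" and X: "set as \<union> set bs = {1..2 * n}"
    using permutes_crossout_run[OF w] by blast
  note uniq = crossout_run_unique[OF w run X]
  let ?xs = "values_A n w"
  have "?xs \<in> seqs_A n"
    using bij_betwE[OF bij_betw_values_positions[of n]] w by blast
  then have xs: "distinct ?xs" "length ?xs = n" "set ?xs \<subseteq> {1..2 * n}"
    by (auto simp: seqs_A_def)
  show path: "path_A n w = path_with_down_steps n (set ?xs)"
    by (simp add: path_A_def uniq)
  have pos: "w (pos_A n w i) = ?xs ! (i - 1)" if "i \<in> {1..n}" for i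
    using that uniq by (auto simp: pos_A_def)
  have down: "nth_down_step (path_A n w) i = sorted_list_of_set (set ?xs) ! (i - 1)" for i
    using xs by (simp add: nth_down_step_def path down_steps_path_with_down_steps)
  have "bij_betw (nth_down_step (path_A n w)) {1..n} (set ?xs)"
    using bij_betw_nth_pred[of "sorted_list_of_set (set ?xs)" n] xs
    by (simp add: down[abs_def] distinct_card)
  moreover have "bij_betw (\<lambda>i. w (pos_A n w i)) {1..n} (set ?xs)"
    using bij_betw_nth_pred[OF xs(1,2)]
    by (rule bij_betw_cong[THEN iffD2, rotated]) (simp add: pos)
  ultimately have "perm_J n w permutes {1..n} \<and>
      (\<forall>i\<in>{1..n}. w (pos_A n w i) = nth_down_step (path_A n w) (perm_J n w i))"
    unfolding perm_J_def by (rule theI'[OF ex1_permutes_matching])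
  then have J: "perm_J n w permutes {1..n}"
    and match: "\<And>i. i \<in> {1..n} \<Longrightarrow> ?xs ! (i - 1) = sorted_list_of_set (set ?xs) ! (perm_J n w i - 1)"
    by (simp_all add: pos down)
  \<comment> \<open>The equation \<open>pos\<close> is restricted to indices in
    \<open>{1..n}\<close>, so the rewriting goes through the fact that
    \<open>inv (perm_J n w)\<close> preserves this range.\<close>
  have "labels_A n w = map (\<lambda>k. 1 + int (card {j \<in> {1..n}. j < inv (perm_J n w) k \<and>
      ?xs ! (j - 1) > ?xs ! (inv (perm_J n w) k - 1)})) [1..<n + 1]"
    unfolding labels_A_def Let_def
  proof (rule map_cong[OF refl])
    fix k assume "k \<in> set [1..<n + 1]"
    then have "inv (perm_J n w) k \<in> {1..n}"
      using permutes_in_image[OF permutes_inv[OF J], of k] by auto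
    then have "{j \<in> {1..n}. j < inv (perm_J n w) k \<and>
          w (pos_A n w j) > w (pos_A n w (inv (perm_J n w) k))} =
        {j \<in> {1..n}. j < inv (perm_J n w) k \<and> ?xs ! (j - 1) > ?xs ! (inv (perm_J n w) k - 1)}"
      using pos by auto
    then show "1 + int (card {j \<in> {1..n}. j < inv (perm_J n w) k \<and>
          w (pos_A n w j) > w (pos_A n w (inv (perm_J n w) k))}) =
        1 + int (card {j \<in> {1..n}. j < inv (perm_J n w) k \<and>
          ?xs ! (j - 1) > ?xs ! (inv (perm_J n w) k - 1)})" by simp
  qed
  also have "\<dots> = inv_labels ?xs"
    by (rule inv_labels_permuted[OF xs(1,2) J match])
  finally show "labels_A n w = inv_labels ?xs" .
qed

lemma labels_B_eq:
  assumes w: "w permutes {1..2 * n}"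
  shows "path_B n w = path_of_B n (set (positions_B n w))"
    and "labels_B n w = inv_labels (positions_B n w)"
proof -
  obtain as bs where run: "crossout_run w as bs" and X: "set as \<union> set bs = {1..2 * n}"
    using permutes_crossout_run[OF w] by blast
  note uniq = crossout_run_unique[OF w run X]
  let ?xs = "positions_B n w"
  have "?xs \<in> seqs_B n"
    using bij_betwE[OF bij_betw_values_positions[of n]] w by blast
  then have xs: "distinct ?xs" "length ?xs = n" "set ?xs \<subseteq> {1..2 * n}"
    by (auto simp: seqs_B_def)
  then have S: "set ?xs \<in> half_subsets n" by (simp add: half_subsets_def distinct_card)
  show path: "path_B n w = path_of_B n (set ?xs)"
    by (simp add: path_B_def path_of_B_def down_set_B_def uniq)
  have pos: "pos_B n w i = ?xs ! (i - 1)" for i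
    by (simp add: pos_B_def positions_B_def)
  have down: "nth_down_step (path_B n w) i = sorted_list_of_set (set ?xs) ! (i - 1) + 1"
    if "i \<in> {1..n}" for i
    using nth_down_step_B[OF S, of "i - 1"] that by (cases i) (simp_all add: path)
  have Suc: "bij_betw (\<lambda>x. x + 1) (set ?xs) (Suc ` set ?xs)"
    by (simp add: bij_betw_def)
  \<comment> \<open>Restricting the index to \<open>{1..n}\<close> leaves out the unlabelled last
    down step; the others are the B-positions shifted by 1.\<close>
  have "bij_betw (\<lambda>i. sorted_list_of_set (set ?xs) ! (i - 1) + 1) {1..n} (Suc ` set ?xs)"
    using bij_betw_trans[OF bij_betw_nth_pred[of "sorted_list_of_set (set ?xs)" n], of "\<lambda>x. x + 1"] xs Suc
    by (simp add: distinct_card comp_def)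
  then have "bij_betw (nth_down_step (path_B n w)) {1..n} (Suc ` set ?xs)"
    by (rule bij_betw_cong[THEN iffD2, rotated]) (simp add: down)
  moreover have "bij_betw (\<lambda>i. pos_B n w i + 1) {1..n} (Suc ` set ?xs)"
    using bij_betw_trans[OF bij_betw_nth_pred[OF xs(1,2)] Suc] by (simp add: comp_def pos)
  ultimately have K': "perm_K n w permutes {1..n} \<and>
      (\<forall>i\<in>{1..n}. pos_B n w i + 1 = nth_down_step (path_B n w) (perm_K n w i))"
    unfolding perm_K_def by (rule theI'[OF ex1_permutes_matching])
  then have K: "perm_K n w permutes {1..n}" by blast
  have match: "?xs ! (i - 1) = sorted_list_of_set (set ?xs) ! (perm_K n w i - 1)"
    if i: "i \<in> {1..n}" for i
  proof -
    have "perm_K n w i \<in> {1..n}" using permutes_in_image[OF K] i by blast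
    then have "pos_B n w i + 1 = sorted_list_of_set (set ?xs) ! (perm_K n w i - 1) + 1"
      using K' i down by metis
    then show ?thesis by (simp add: pos)
  qed
  show "labels_B n w = inv_labels ?xs"
    unfolding labels_B_def Let_def pos by (rule inv_labels_permuted[OF xs(1,2) K match])
qed

section \<open>The correspondence as a composition of bijections\<close>

theorem theorem1:
  fixes n :: nat
  assumes "n \<ge> 1"
  shows "bij_betw (crossout n)
     {w. w permutes {1..2 * n}}
     {(pA, pB, ls, ms).
        dyck_path n pA \<and> dyck_path (n + 1) pB \<and>
        length ls = n \<and> (\<forall>i\<in>{1..n}. 1 \<le> ls ! (i - 1) \<and> ls ! (i - 1) \<le> down_height pA i) \<and>
        length ms = n \<and> (\<forall>i\<in>{1..n}. 1 \<le> ms ! (i - 1) \<and> ms ! (i - 1) \<le> down_height_star pB i)}"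
    (is "bij_betw _ _ ?T")
proof -
  let ?FA = "\<lambda>xs. (path_with_down_steps n (set xs), inv_labels xs)"
  let ?FB = "\<lambda>xs. (path_of_B n (set xs), inv_labels xs)"
  let ?V = "\<lambda>w. (values_A n w, positions_B n w)"
  let ?swap = "\<lambda>((pA, ls), (pB, ms)). (pA, pB, ls, ms)"
  have "bij_betw (map_prod ?FA ?FB) (seqs_A n \<times> seqs_B n) (histories_A n \<times> histories_B n)"
    by (intro bij_betw_map_prod bij_betw_seqs_A bij_betw_seqs_B)
  moreover have "bij_betw ?swap (histories_A n \<times> histories_B n) ?T"
    by (rule bij_betwI[where g = "\<lambda>(pA, pB, ls, ms). ((pA, ls), (pB, ms))"])
      (auto simp: histories_A_def histories_B_def)
  ultimately have "bij_betw (?swap \<circ> (map_prod ?FA ?FB \<circ> ?V)) {w. w permutes {1..2 * n}} ?T"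
    using bij_betw_values_positions by (blast intro: bij_betw_trans)
  then show ?thesis
    by (rule bij_betw_cong[THEN iffD2, rotated]) (simp add: crossout_def labels_A_eq labels_B_eq)
qed

end
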